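(* For every even order $m=2k\ge 4$ there are SOS-Hankel tensors of order $m$ which are not completely decomposable; that is, for every integer $k\ge 2$, with $m=2k$, there exist an integer $n\ge 2$ and a Hankel tensor $\mathcal{A}$ of order $m$ and dimension $n$ which is an SOS tensor but is not a completely decomposable tensor.
   Context: Write $[n]=\{1,\dots,n\}$. $\mathrm{S}_{m,n}$ is the space of real symmetric tensors $\mathcal{A}=(a_{i_1\cdots i_m})$, $i_j\in[n]$, of order $m$ and dimension $n$. For $\mathbf{x}\in\mathbb{R}^n$, $\mathbf{x}^{\otimes m}$ is the tensor with entries $x_{i_1}\cdots x_{i_m}$, and $\mathcal{A}\mathbf{x}^{\otimes m}=\sum_{i_1,\dots,i_m\in[n]}a_{i_1\cdots i_m}x_{i_1}\cdots x_{i_m}$. Hankel tensor: $\mathcal{A}\in \mathrm{S}_{m,n}$ such that for some vector $(v_0,\dots,v_{(n-1)m})^\top$ one has $a_{i_1\cdots i_m}=v_{i_1+\cdots+i_m-m}$ for all $i_1,\dots,i_m\in[n]$. SOS tensor ($m$ even): $\mathcal{A}$ such that the polynomial $\mathbf{x}\mapsto\mathcal{A}\mathbf{x}^{\otimes m}$ is a sum of squares of real polynomials of degree $m/2$. An SOS-Hankel tensor is a Hankel tensor that is an SOS tensor. Completely decomposable tensor: $\mathcal{A}\in\mathrm{S}_{m,n}$ such that $\mathcal{A}=\sum_{j=1}^r\mathbf{x}_j^{\otimes m}$ for some $r$ and some $\mathbf{x}_1,\dots,\mathbf{x}_r\in\mathbb{R}^n$. *)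

theory Defs
  imports Complex_Main "HOL-Library.Multiset" "HOL-Library.Poly_Mapping"
begin

text \<open>
  The order \<open>m\<close> and the dimension \<open>n\<close> are numbers that may be quantified over, so a tensor
  is an entry function on index lists \<open>[i\<^sub>1, \<dots>, i\<^sub>m]\<close>, and a vector of dimension \<open>n\<close> is a function
  on \<open>{1..n}\<close>. Values outside \<open>index_tuples m n\<close> and outside \<open>{1..n}\<close> are irrelevant:
  all notions below only inspect values inside these sets.
\<close>

type_synonym tensor = "nat list \<Rightarrow> real"

definition index_tuples :: "nat \<Rightarrow> nat \<Rightarrow> nat list set" where
  "index_tuples m n = {is. length is = m \<and> set is \<subseteq> {1..n}}"

definition symmetric_tensor :: "nat \<Rightarrow> nat \<Rightarrow> tensor \<Rightarrow> bool" where
  "symmetric_tensor m n A \<longleftrightarrow>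
     (\<forall>is \<in> index_tuples m n. \<forall>js. mset js = mset is \<longrightarrow> A js = A is)"

definition tensor_power :: "(nat \<Rightarrow> real) \<Rightarrow> tensor" where
  "tensor_power x is = prod_list (map x is)"

definition tensor_form :: "nat \<Rightarrow> nat \<Rightarrow> tensor \<Rightarrow> (nat \<Rightarrow> real) \<Rightarrow> real" where
  "tensor_form m n A x = (\<Sum>is \<in> index_tuples m n. A is * tensor_power x is)"

text \<open>
  The subtraction on natural numbers below does not truncate, because all indices are at least 1;
  the arguments of \<open>v\<close> range over \<open>{0..(n - 1) * m}\<close>.
\<close>

definition hankel_tensor :: "nat \<Rightarrow> nat \<Rightarrow> tensor \<Rightarrow> bool" where
  "hankel_tensor m n A \<longleftrightarrow> symmetric_tensor m n A \<and>
     (\<exists>v :: nat \<Rightarrow> real. \<forall>is \<in> index_tuples m n. A is = v (sum_list is - m))"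

text \<open>
  A multivariate polynomial is a finitely supported family of real coefficients, indexed by
  exponent vectors, which are themselves finitely supported.
\<close>

type_synonym real_mpoly = "(nat \<Rightarrow>\<^sub>0 nat) \<Rightarrow>\<^sub>0 real"

definition polys_in :: "nat \<Rightarrow> real_mpoly set" where
  "polys_in n = {p. \<forall>e \<in> Poly_Mapping.keys p. Poly_Mapping.keys e \<subseteq> {1..n}}"

definition total_degree :: "real_mpoly \<Rightarrow> nat" where
  "total_degree p = Max (insert 0
     ((\<lambda>e. \<Sum>i \<in> Poly_Mapping.keys e. Poly_Mapping.lookup e i) ` Poly_Mapping.keys p))"

definition eval_poly :: "real_mpoly \<Rightarrow> (nat \<Rightarrow> real) \<Rightarrow> real" where
  "eval_poly p x = (\<Sum>e \<in> Poly_Mapping.keys p. Poly_Mapping.lookup p e *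
     (\<Prod>i \<in> Poly_Mapping.keys e. x i ^ Poly_Mapping.lookup e i))"

text \<open>
  The polynomial identity is stated as an identity of functions, which is the same thing over the
  reals. The zero tensor is covered by the empty sum \<open>r = 0\<close>. Since the form of \<open>A\<close> is homogeneous
  of degree \<open>m\<close>, allowing squares of polynomials of degree less than \<open>m div 2\<close> would give
  the same notion.
\<close>

definition sos_tensor :: "nat \<Rightarrow> nat \<Rightarrow> tensor \<Rightarrow> bool" where
  "sos_tensor m n A \<longleftrightarrow> even m \<and> symmetric_tensor m n A \<and>
     (\<exists>(r :: nat) q. (\<forall>j \<in> {1..r}. q j \<in> polys_in n \<and> total_degree (q j) = m div 2) \<and>
        (\<forall>x. tensor_form m n A x = (\<Sum>j = 1..r. (eval_poly (q j) x)\<^sup>2)))"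

definition sos_hankel_tensor :: "nat \<Rightarrow> nat \<Rightarrow> tensor \<Rightarrow> bool" where
  "sos_hankel_tensor m n A \<longleftrightarrow> hankel_tensor m n A \<and> sos_tensor m n A"

definition completely_decomposable :: "nat \<Rightarrow> nat \<Rightarrow> tensor \<Rightarrow> bool" where
  "completely_decomposable m n A \<longleftrightarrow> symmetric_tensor m n A \<and>
     (\<exists>(r :: nat) (X :: nat \<Rightarrow> nat \<Rightarrow> real).
        \<forall>is \<in> index_tuples m n. A is = (\<Sum>j = 1..r. tensor_power (X j) is))"

end

theory Submission imports Defs begin

text \<open>
  In dimension 2 every symmetric tensor is a Hankel tensor: an index tuple over \<open>{1, 2}\<close> is
  determined up to order by its number of twos, which is the excess of its index sum over its
  length. So Hankel tensors of dimension 2 are just binary forms, and it suffices to find a binary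
  form of degree \<open>m = 2 * k\<close> that is a sum of squares but not a sum of \<open>m\<close>-th powers of linear
  forms.

  A positive multiple of \<open>x\<^sub>1\<^bsup>m - 2\<^esup> x\<^sub>2\<^sup>2 = (x\<^sub>1\<^bsup>k - 1\<^esup> x\<^sub>2)\<^sup>2\<close> does this
  (\<open>pair_tensor_sos\<close>, \<open>pair_tensor_not_decomposable\<close>). In a sum of even powers
  \<open>(a\<^sub>j x\<^sub>1 + b\<^sub>j x\<^sub>2)\<^bsup>m\<^esup>\<close>, the absence of \<open>x\<^sub>1\<^bsup>m\<^esup>\<close> forces every \<open>a\<^sub>j\<close> to vanish, and then no monomial
  involving \<open>x\<^sub>1\<close> survives. Here \<open>k \<ge> 2\<close> enters: \<open>x\<^sub>1\<^bsup>m - 2\<^esup> x\<^sub>2\<^sup>2\<close> really involves \<open>x\<^sub>1\<close>.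
\<close>

lemma sum_list_over_1_2:
  assumes "set is \<subseteq> {1, 2::nat}"
  shows "sum_list is = length is + count_list is 2"
  using assms by (induction "is") auto

lemma length_over_1_2:
  assumes "set is \<subseteq> {1, 2::nat}"
  shows "length is = count_list is 1 + count_list is 2"
  using assms by (induction "is") auto

lemma tensor_power_over_1_2:
  assumes "set is \<subseteq> {1, 2}"
  shows "tensor_power x is = x 1 ^ count_list is 1 * x 2 ^ count_list is 2"
  using assms by (induction "is") (auto simp: tensor_power_def mult_ac)

lemma index_tuples_2: "index_tuples m 2 = {is. length is = m \<and> set is \<subseteq> {1, 2}}"
proof -
  have "{1..2::nat} = {1, 2}" by auto
  then show ?thesis by (simp add: index_tuples_def)
qed

text \<open>
  On index tuples of length \<open>m\<close> over \<open>{1, 2}\<close> this is the indicator of those with exactly two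
  twos, that is, the tensor of the binary form \<open>(m choose 2) x\<^sub>1\<^bsup>m - 2\<^esup> x\<^sub>2\<^sup>2\<close>.
\<close>
definition pair_tensor :: "nat \<Rightarrow> tensor" where
  "pair_tensor m is = (if sum_list is - m = 2 then 1 else 0)"

lemma pair_tensor_eq:
  assumes "is \<in> index_tuples m 2"
  shows "pair_tensor m is = (if count_list is 2 = 2 then 1 else 0)"
  using assms by (simp add: pair_tensor_def index_tuples_2 sum_list_over_1_2)

lemma pair_tensor_hankel: "hankel_tensor m n (pair_tensor m)"
proof -
  have "pair_tensor m js = pair_tensor m is" if "mset js = mset is" for "is" js
  proof -
    have "sum_list js = sum_list is"
      by (simp add: that flip: sum_mset_sum_list)
    then show ?thesis by (simp only: pair_tensor_def)
  qed
  then have "symmetric_tensor m n (pair_tensor m)"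
    unfolding symmetric_tensor_def by blast
  moreover have "\<exists>v :: nat \<Rightarrow> real. \<forall>is \<in> index_tuples m n. pair_tensor m is = v (sum_list is - m)"
    by (rule exI[of _ "\<lambda>s. if s = 2 then 1 else 0"]) (simp add: pair_tensor_def)
  ultimately show ?thesis
    by (simp only: hankel_tensor_def)
qed

lemma pair_tensor_form:
  "tensor_form m 2 (pair_tensor m) x =
     of_nat (card {is \<in> index_tuples m 2. count_list is 2 = 2}) * (x 1 ^ (m - 2) * (x 2)\<^sup>2)"
proof -
  have fin: "finite (index_tuples m 2)"
    using finite_lists_length_eq[of "{1..2::nat}" m]
    by (simp add: index_tuples_def conj_commute)
  have "tensor_form m 2 (pair_tensor m) x =
      (\<Sum>is \<in> index_tuples m 2. if count_list is 2 = 2 then x 1 ^ (m - 2) * (x 2)\<^sup>2 else 0)"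
    unfolding tensor_form_def
  proof (rule sum.cong[OF refl])
    fix "is" assume mem: "is \<in> index_tuples m 2"
    then have "set is \<subseteq> {1, 2}" "length is = m" by (auto simp: index_tuples_2)
    with length_over_1_2[of "is"] tensor_power_over_1_2[of "is" x]
    show "pair_tensor m is * tensor_power x is =
        (if count_list is 2 = 2 then x 1 ^ (m - 2) * (x 2)\<^sup>2 else 0)"
      unfolding pair_tensor_eq[OF mem] by auto
  qed
  also have "\<dots> = (\<Sum>is \<in> {is \<in> index_tuples m 2. count_list is 2 = 2}. x 1 ^ (m - 2) * (x 2)\<^sup>2)"
    by (rule sum.inter_filter[OF fin, symmetric])
  finally show ?thesis by simp
qed

definition monomial_1_2 :: "nat \<Rightarrow> nat \<Rightarrow> real_mpoly" where
  "monomial_1_2 a b = Poly_Mapping.single (Poly_Mapping.single 1 a + Poly_Mapping.single 2 b) 1"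

lemma keys_exponent_1_2:
  assumes "a \<noteq> 0" "b \<noteq> 0"
  shows "Poly_Mapping.keys (Poly_Mapping.single 1 a + Poly_Mapping.single (2::nat) b) = {1, 2::nat}"
  using assms
  by (auto simp: in_keys_iff lookup_add lookup_single when_def split: if_splits)

lemma monomial_1_2:
  assumes "a \<noteq> 0" "b \<noteq> 0"
  shows "monomial_1_2 a b \<in> polys_in 2"
    and "total_degree (monomial_1_2 a b) = a + b"
    and "eval_poly (monomial_1_2 a b) x = x 1 ^ a * x 2 ^ b"
  by (auto simp: polys_in_def total_degree_def eval_poly_def monomial_1_2_def
      keys_exponent_1_2[OF assms, simplified] lookup_add lookup_single)

text \<open>
  The positive integer coefficient of the form is absorbed by repeating the square
  \<open>(x\<^sub>1\<^bsup>k - 1\<^esup> x\<^sub>2)\<^sup>2\<close> that many times.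
\<close>
lemma pair_tensor_sos:
  assumes "k \<ge> 2"
  shows "sos_tensor (2 * k) 2 (pair_tensor (2 * k))"
proof -
  define c where "c = card {is \<in> index_tuples (2 * k) 2. count_list is 2 = 2}"
  have nz: "k - 1 \<noteq> 0" "1 \<noteq> (0::nat)" using assms by auto
  have "(x 1 ^ (k - 1) * x 2 ^ 1)\<^sup>2 = x 1 ^ (2 * k - 2) * (x 2)\<^sup>2" for x :: "nat \<Rightarrow> real"
    by (simp add: power_mult_distrib right_diff_distrib' mult.commute flip: power_mult)
  then have form: "tensor_form (2 * k) 2 (pair_tensor (2 * k)) x =
      (\<Sum>j = 1..c. (eval_poly (monomial_1_2 (k - 1) 1) x)\<^sup>2)" for x
    unfolding pair_tensor_form monomial_1_2(3)[OF nz] c_def by simp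
  have q: "monomial_1_2 (k - 1) 1 \<in> polys_in 2"
    "total_degree (monomial_1_2 (k - 1) 1) = 2 * k div 2"
    using monomial_1_2(1,2)[OF nz] assms by auto
  have sym: "symmetric_tensor (2 * k) 2 (pair_tensor (2 * k))"
    using pair_tensor_hankel unfolding hankel_tensor_def by blast
  have squares: "\<exists>(r :: nat) p. (\<forall>j \<in> {1..r}. p j \<in> polys_in 2 \<and> total_degree (p j) = 2 * k div 2) \<and>
      (\<forall>x. tensor_form (2 * k) 2 (pair_tensor (2 * k)) x = (\<Sum>j = 1..r. (eval_poly (p j) x)\<^sup>2))"
    by (rule exI[of _ c], rule exI[of _ "\<lambda>_. monomial_1_2 (k - 1) 1"])
      (use form q in blast)
  show ?thesis
    unfolding sos_tensor_def by (intro conjI sym squares) simp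
qed

text \<open>
  Two entries already contradict a decomposition: the entry at \<open>(1, \<dots>, 1)\<close> is 0 and equals
  \<open>\<Sum>\<^sub>j a\<^sub>j\<^bsup>m\<^esup>\<close> with \<open>m\<close> even, so every \<open>a\<^sub>j\<close> is 0, while the entry at \<open>(2, 2, 1, \<dots>, 1)\<close> is 1 and
  equals \<open>\<Sum>\<^sub>j b\<^sub>j\<^sup>2 a\<^sub>j\<^bsup>m - 2\<^esup>\<close>.
\<close>
lemma pair_tensor_not_decomposable:
  assumes "even m" "m > 2"
  shows "\<not> completely_decomposable m 2 (pair_tensor m)"
proof
  assume "completely_decomposable m 2 (pair_tensor m)"
  then obtain r :: nat and X :: "nat \<Rightarrow> nat \<Rightarrow> real" where
    X: "\<And>is. is \<in> index_tuples m 2 \<Longrightarrow> pair_tensor m is = (\<Sum>j = 1..r. tensor_power (X j) is)"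
    unfolding completely_decomposable_def by blast
  have ones: "replicate m 1 \<in> index_tuples m 2"
    by (auto simp: index_tuples_2)
  have "(\<Sum>j = 1..r. X j 1 ^ m) = 0"
    using X[OF ones] by (simp add: tensor_power_def pair_tensor_def sum_list_replicate)
  then have "\<forall>j \<in> {1..r}. X j 1 ^ m = 0"
    using assms by (subst (asm) sum_nonneg_eq_0_iff) auto
  then have a: "X j 1 = 0" if "j \<in> {1..r}" for j
    using that by auto
  define t where "t = 2 # 2 # replicate (m - 2) (1::nat)"
  have t: "t \<in> index_tuples m 2"
    using assms by (auto simp: index_tuples_2 t_def)
  have "pair_tensor m t = 1"
    using assms by (simp add: pair_tensor_def t_def sum_list_replicate)
  moreover have "tensor_power (X j) t = 0" if "j \<in> {1..r}" for j
    using a[OF that] assms by (simp add: tensor_power_def t_def)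
  ultimately show False
    using X[OF t] by simp
qed

theorem mainTheorem4:
  fixes k m :: nat
  assumes "k \<ge> 2" and "m = 2 * k"
  shows "\<exists>n \<ge> 2. \<exists>A :: tensor. sos_hankel_tensor m n A \<and> \<not> completely_decomposable m n A"
proof (intro exI conjI)
  show "sos_hankel_tensor m 2 (pair_tensor m)"
    using pair_tensor_hankel pair_tensor_sos[OF assms(1)] assms(2)
    by (simp add: sos_hankel_tensor_def)
  show "\<not> completely_decomposable m 2 (pair_tensor m)"
    using assms by (intro pair_tensor_not_decomposable) auto
qed simp

end
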